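(* For the randomized two-stage Runge-Kutta method, the region of stability in probability and the region of asymptotic stability coincide: $$\mathcal{R}^{SP}=\{z\in\mathbb{C}:\mathbb{E}(\ln|p_1(z)|)<0\}=\mathcal{R}^{AS}.$$
   Context: Let $(\tau_j)_{j\in\mathbb{N}}$ be i.i.d. random variables uniformly distributed on $[0,1]$ on a complete probability space $(\Omega,\Sigma,\mathbb{P})$. For $z\in\mathbb{C}$ put $p_j(z)=\tau_jz^2+z+1$. Fix $\eta\ne0$. Applying the randomized two-stage Runge-Kutta method with step-size $h>0$ to the test problem $z'(t)=\lambda z(t)$, $t\ge0$, $z(0)=\eta$ ($\lambda\in\mathbb{C}$), and substituting $z=h\lambda$, gives $V^0=\eta$ and $V^k=V^k(z)=\eta\prod_{j=1}^kp_j(z)$, $k\in\mathbb{N}$. Define $\mathcal{R}^{AS}=\{z\in\mathbb{C}:V^k\to0\text{ almost surely as }k\to\infty\}$ and $\mathcal{R}^{SP}=\{z\in\mathbb{C}:V^k\to0\text{ in probability as }k\to\infty\}$. For every $z\in\mathbb{C}$, $|p_1(z)|>0$ almost surely and $\ln|p_1(z)|$ is integrable. *)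

theory Defs
  imports "HOL-Probability.Probability"
begin

(* One step of the randomized two-stage Runge-Kutta method for z'(t) = lambda z(t) multiplies
   the current value by rk_factor, where z stands for the product of the step size h and
   lambda.  Steps are numbered from 1, so \<tau> 0 is never used. *)
definition rk_factor :: "(nat \<Rightarrow> 'a \<Rightarrow> real) \<Rightarrow> nat \<Rightarrow> complex \<Rightarrow> 'a \<Rightarrow> complex" where
  "rk_factor \<tau> j z \<omega> = complex_of_real (\<tau> j \<omega>) * z\<^sup>2 + z + 1"

definition rk_approx :: "(nat \<Rightarrow> 'a \<Rightarrow> real) \<Rightarrow> complex \<Rightarrow> complex \<Rightarrow> nat \<Rightarrow> 'a \<Rightarrow> complex" where
  "rk_approx \<tau> \<eta> z k \<omega> = \<eta> * (\<Prod>j=1..k. rk_factor \<tau> j z \<omega>)"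

definition tendsto_zero_AS :: "'a measure \<Rightarrow> (nat \<Rightarrow> 'a \<Rightarrow> complex) \<Rightarrow> bool" where
  "tendsto_zero_AS M X \<longleftrightarrow> (AE \<omega> in M. (\<lambda>k. X k \<omega>) \<longlonglongrightarrow> 0)"

definition tendsto_zero_prob :: "'a measure \<Rightarrow> (nat \<Rightarrow> 'a \<Rightarrow> complex) \<Rightarrow> bool" where
  "tendsto_zero_prob M X \<longleftrightarrow>
     (\<forall>\<epsilon>>0. (\<lambda>k. measure M {\<omega> \<in> space M. cmod (X k \<omega>) > \<epsilon>}) \<longlonglongrightarrow> 0)"

definition region_AS :: "'a measure \<Rightarrow> (nat \<Rightarrow> 'a \<Rightarrow> real) \<Rightarrow> complex \<Rightarrow> complex set" where
  "region_AS M \<tau> \<eta> = {z. tendsto_zero_AS M (rk_approx \<tau> \<eta> z)}"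

definition region_SP :: "'a measure \<Rightarrow> (nat \<Rightarrow> 'a \<Rightarrow> real) \<Rightarrow> complex \<Rightarrow> complex set" where
  "region_SP M \<tau> \<eta> = {z. tendsto_zero_prob M (rk_approx \<tau> \<eta> z)}"

end

theory Submission
  imports Defs
begin

text \<open>
  Put \<open>P\<^sub>j = |p\<^sub>j(z)|\<close> and \<open>\<mu> = E(ln P\<^sub>1)\<close>. Up to the factor \<open>|\<eta>|\<close>, the modulus of \<open>V\<^sup>k\<close> is the
  product of the independent, identically distributed and almost surely positive variables
  \<open>P\<^sub>1, ..., P\<^sub>k\<close>, so its logarithm is a random walk with drift \<open>\<mu>\<close>. The theorem follows from the
  cycle of implications \<open>\<mu> < 0\<close> \<open>\<Longrightarrow>\<close> almost sure convergence \<open>\<Longrightarrow>\<close> convergence in probability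
  \<open>\<Longrightarrow>\<close> \<open>\<mu> < 0\<close>.

  For the first implication, the map \<open>s \<mapsto> E(P\<^sub>1 powr s)\<close> has value \<open>1\<close> and right derivative
  \<open>\<mu> < 0\<close> at \<open>0\<close>, so some moment \<open>\<rho> = E(P\<^sub>1 powr s)\<close> with \<open>s > 0\<close> is less than \<open>1\<close>
  (\<open>fractional_moment_less_one\<close>). By independence the \<open>s\<close>-th moment of the \<open>k\<close>-fold product is
  \<open>\<rho> ^ k\<close>, which is summable; hence the \<open>s\<close>-th powers of the products are almost surely summable and
  tend to \<open>0\<close> (\<open>iid_prod_tendsto_zero_AE\<close>).

  The last implication is proved by contraposition. If \<open>\<mu> \<ge> 0\<close>, the random walk is at least as large as
  its centred version, and by the central limit theorem the latter is positive with a probability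
  whose limit is positive, unless the steps are degenerate (\<open>iid_sum_nonneg_prob_not_null\<close>); where the walk is nonnegative,
  \<open>|V\<^sup>k| \<ge> |\<eta>|\<close>. The central limit theorem needs the second moment of \<open>ln P\<^sub>1\<close>, which is finite because a zero of \<open>x z\<^sup>2 + z + 1\<close> at a real \<open>x\<close> produces only a logarithmic singularity, whose
  square is dominated by an inverse square root (\<open>integrable_ln_quad_modulus_squared\<close>).
\<close>

section \<open>Independent random variables\<close>

lemma (in prob_space) indep_vars_reindex:
  assumes indep: "indep_vars N X I" and f: "inj_on f J" "f ` J \<subseteq> I"
  shows "indep_vars (\<lambda>j. N (f j)) (\<lambda>j. X (f j)) J"
proof -
  let ?F = "\<lambda>i. {X i -` A \<inter> space M | A. A \<in> sets (N i)}"
  have rv: "random_variable (N i) (X i)" if "i \<in> I" for i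
    using indep that by (auto simp: indep_vars_def2)
  have F: "indep_sets ?F I"
    using indep by (simp add: indep_vars_def2)
  have "indep_sets (\<lambda>j. ?F (f j)) J"
  proof (rule indep_setsI)
    show "?F (f j) \<subseteq> events" if "j \<in> J" for j
      using rv[of "f j"] f(2) that by (auto intro: measurable_sets)
  next
    (* A family of events on J is carried over to the image f ` K along the inverse of f. *)
    fix A K assume K: "K \<noteq> {}" "K \<subseteq> J" "finite K" and A: "\<forall>j\<in>K. A j \<in> ?F (f j)"
    have inj: "inj_on f K" using f(1) K(2) by (rule inj_on_subset)
    let ?B = "\<lambda>i. A (the_inv_into K f i)"
    have B: "?B (f j) = A j" if "j \<in> K" for j
      using that by (simp add: the_inv_into_f_f[OF inj])
    have "prob (\<Inter>i\<in>f ` K. ?B i) = (\<Prod>i\<in>f ` K. prob (?B i))"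
      by (rule indep_setsD[OF F]) (use K f(2) A B in auto)
    then show "prob (\<Inter>j\<in>K. A j) = (\<Prod>j\<in>K. prob (A j))"
      using inj B by (simp add: prod.reindex)
  qed
  then show ?thesis
    using rv f(2) unfolding indep_vars_def2 by auto
qed

section \<open>Products with negative logarithmic mean\<close>

text \<open>
  The function \<open>s \<mapsto> p powr s\<close> is convex, so its difference quotient at \<open>0\<close> lies between the
  derivative \<open>ln p\<close> and the chord slope \<open>p - 1\<close> over the unit interval. The bound does not depend on
  \<open>s\<close>, as a dominating function requires.
\<close>

lemma powr_difference_quotient_bound:
  fixes p s :: real
  assumes p: "p > 0" and s: "0 < s" "s \<le> 1"
  shows "\<bar>(p powr s - 1) / s\<bar> \<le> \<bar>ln p\<bar> + p"
proof -
  have "1 + s * ln p \<le> p powr s"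
    using p exp_ge_add_one_self[of "s * ln p"] by (simp add: powr_def)
  then have lower: "ln p \<le> (p powr s - 1) / s"
    using s by (simp add: field_simps)
  have "p powr s * 1 powr (1 - s) \<le> s * p + (1 - s) * 1"
    by (rule Youngs_inequality_0) (use p s in auto)
  then have upper: "(p powr s - 1) / s \<le> p - 1"
    using s by (simp add: field_simps)
  show ?thesis
    using lower upper p by linarith
qed

text \<open>
  The derivative at \<open>0\<close> of the moment function \<open>s \<mapsto> E(P powr s)\<close> is \<open>E(ln P)\<close>, by dominated
  convergence of the difference quotients; a negative derivative pushes the moment below its value
  \<open>1\<close> at \<open>0\<close>.
\<close>

lemma (in prob_space) fractional_moment_less_one:
  fixes P :: "'a \<Rightarrow> real"
  assumes P: "integrable M P" "AE \<omega> in M. P \<omega> > 0"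
    and ln_P: "integrable M (\<lambda>\<omega>. ln (P \<omega>))" "expectation (\<lambda>\<omega>. ln (P \<omega>)) < 0"
  shows "\<exists>s>0. integrable M (\<lambda>\<omega>. P \<omega> powr s) \<and> expectation (\<lambda>\<omega>. P \<omega> powr s) < 1"
proof -
  define s :: "nat \<Rightarrow> real" where "s n = inverse (real (Suc n))" for n
  have s: "0 < s n" "s n \<le> 1" for n
    by (auto simp: s_def field_simps)
  have s_lim: "filterlim s (at 0) sequentially"
    using LIMSEQ_inverse_real_of_nat by (auto simp: filterlim_at s_def[abs_def])
  let ?F = "\<lambda>n \<omega>. (P \<omega> powr s n - 1) / s n"
  have [measurable]: "P \<in> borel_measurable M"
    using P(1) by auto
  have dom: "integrable M (\<lambda>\<omega>. \<bar>ln (P \<omega>)\<bar> + P \<omega>)"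
    using P(1) ln_P(1) by simp
  have bound: "AE \<omega> in M. norm (?F n \<omega>) \<le> \<bar>ln (P \<omega>)\<bar> + P \<omega>" for n
    using P(2)
  proof eventually_elim
    case (elim \<omega>)
    then show ?case
      using powr_difference_quotient_bound[of "P \<omega>" "s n"] s[of n] by simp
  qed
  have ptw: "AE \<omega> in M. (\<lambda>n. ?F n \<omega>) \<longlonglongrightarrow> ln (P \<omega>)"
    using P(2)
  proof eventually_elim
    case (elim \<omega>)
    have "((\<lambda>t. P \<omega> powr t) has_real_derivative ln (P \<omega>)) (at 0)"
      using elim by (auto intro!: derivative_eq_intros)
    then have "((\<lambda>t. (P \<omega> powr t - 1) / t) \<longlongrightarrow> ln (P \<omega>)) (at 0)"
      using elim by (simp add: has_field_derivative_iff)
    from filterlim_compose[OF this s_lim] show ?case .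
  qed
  have "(\<lambda>n. expectation (?F n)) \<longlonglongrightarrow> expectation (\<lambda>\<omega>. ln (P \<omega>))"
    by (rule integral_dominated_convergence[OF _ _ dom ptw bound]) auto
  then have "\<forall>\<^sub>F n in sequentially. expectation (?F n) < 0"
    using ln_P(2) by (rule order_tendstoD)
  then obtain n where n: "expectation (?F n) < 0"
    by (auto simp: eventually_sequentially)
  have F_int: "integrable M (?F n)"
    by (rule Bochner_Integration.integrable_bound[OF dom]) (use bound[of n] in auto)
  have eq: "P \<omega> powr s n = s n * ?F n \<omega> + 1" for \<omega>
    using s(1)[of n] by (simp add: field_simps)
  have "integrable M (\<lambda>\<omega>. s n * ?F n \<omega> + 1)"
    using F_int by (intro Bochner_Integration.integrable_add integrable_mult_right) auto
  then have int: "integrable M (\<lambda>\<omega>. P \<omega> powr s n)"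
    by (simp only: eq[symmetric])
  have "expectation (\<lambda>\<omega>. P \<omega> powr s n) = expectation (\<lambda>\<omega>. s n * ?F n \<omega> + 1)"
    by (simp only: eq[symmetric])
  also have "\<dots> = s n * expectation (?F n) + 1"
    using F_int by (subst Bochner_Integration.integral_add; (intro integrable_mult_right)?)
      (simp_all only: integral_mult_right_zero integrable_const lebesgue_integral_const prob_space scaleR_one)
  also have "\<dots> < 1"
    using mult_pos_neg[OF s(1)[of n] n] by linarith
  finally show ?thesis
    using int s(1) by blast
qed

text \<open>
  With a fractional moment below \<open>1\<close>, the fractional moments of the products decay geometrically. The
  sum over \<open>n\<close> of the powers of the products therefore has finite expectation and is almost surely
  finite, which forces its terms to \<open>0\<close>.
\<close>

lemma (in prob_space) iid_prod_tendsto_zero_AE: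
  fixes P :: "nat \<Rightarrow> 'a \<Rightarrow> real"
  assumes indep: "indep_vars (\<lambda>_. borel) P UNIV"
    and distr: "\<And>i. distr M borel (P i) = distr M borel (P 0)"
    and nonneg: "\<And>i \<omega>. 0 \<le> P i \<omega>"
    and P: "integrable M (P 0)" "AE \<omega> in M. P 0 \<omega> > 0"
    and ln_P: "integrable M (\<lambda>\<omega>. ln (P 0 \<omega>))" "expectation (\<lambda>\<omega>. ln (P 0 \<omega>)) < 0"
  shows "AE \<omega> in M. (\<lambda>n. \<Prod>i<n. P i \<omega>) \<longlonglongrightarrow> 0"
proof -
  obtain s where s: "s > 0" and int0: "integrable M (\<lambda>\<omega>. P 0 \<omega> powr s)"
    and less: "expectation (\<lambda>\<omega>. P 0 \<omega> powr s) < 1"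
    using fractional_moment_less_one[OF P ln_P] by blast
  define \<rho> where "\<rho> = expectation (\<lambda>\<omega>. P 0 \<omega> powr s)"
  have \<rho>: "0 \<le> \<rho>" "\<rho> < 1"
    using less by (auto simp: \<rho>_def)
  have rv [measurable]: "random_variable borel (P i)" for i
    using indep by (auto simp: indep_vars_def2)
  have mom: "(\<integral>\<^sup>+\<omega>. ennreal (P i \<omega> powr s) \<partial>M) = ennreal \<rho>" for i
  proof -
    have "(\<integral>\<^sup>+\<omega>. ennreal (P i \<omega> powr s) \<partial>M) = (\<integral>\<^sup>+x. ennreal (x powr s) \<partial>distr M borel (P i))"
      by (simp add: nn_integral_distr)
    also have "\<dots> = (\<integral>\<^sup>+x. ennreal (x powr s) \<partial>distr M borel (P 0))"
      by (simp only: distr[of i])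
    also have "\<dots> = (\<integral>\<^sup>+\<omega>. ennreal (P 0 \<omega> powr s) \<partial>M)"
      by (simp add: nn_integral_distr)
    also have "\<dots> = ennreal \<rho>"
      unfolding \<rho>_def by (intro nn_integral_eq_integral int0) auto
    finally show ?thesis .
  qed
  have indep_s: "indep_vars (\<lambda>_. borel) (\<lambda>i \<omega>. ennreal (P i \<omega> powr s)) {..<n}" for n
    by (rule indep_vars_compose2[where M'="\<lambda>_. borel" and X = P])
      (auto intro: indep_vars_subset[OF indep])
  have prod_mom: "(\<integral>\<^sup>+\<omega>. (\<Prod>i<n. ennreal (P i \<omega> powr s)) \<partial>M) = ennreal (\<rho> ^ n)" for n
    using indep_vars_nn_integral[OF _ indep_s[of n]] \<rho>(1) by (simp add: mom prod_ennreal ennreal_power)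
  have "(\<integral>\<^sup>+\<omega>. (\<Sum>n. \<Prod>i<n. ennreal (P i \<omega> powr s)) \<partial>M) = (\<Sum>n. ennreal (\<rho> ^ n))"
    by (subst nn_integral_suminf) (auto simp: prod_mom)
  also have "\<dots> = ennreal (\<Sum>n. \<rho> ^ n)"
    using \<rho> by (intro suminf_ennreal2) (auto intro: summable_geometric)
  finally have "AE \<omega> in M. (\<Sum>n. \<Prod>i<n. ennreal (P i \<omega> powr s)) \<noteq> \<infinity>"
    by (intro nn_integral_PInf_AE) auto
  then show ?thesis
  proof eventually_elim
    case (elim \<omega>)
    let ?Q = "\<lambda>n. \<Prod>i<n. P i \<omega>"
    have Q: "0 \<le> ?Q n" "(\<Prod>i<n. ennreal (P i \<omega> powr s)) = ennreal (?Q n powr s)" for n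
      using nonneg by (auto simp: prod_nonneg prod_powr_distrib prod_ennreal)
    have "summable (\<lambda>n. ?Q n powr s)"
      using elim by (intro summable_suminf_not_top) (auto simp: Q(2))
    then have "(\<lambda>n. ?Q n powr s) \<longlonglongrightarrow> 0"
      by (rule summable_LIMSEQ_zero)
    then have "(\<lambda>n. (?Q n powr s) powr (1/s)) \<longlonglongrightarrow> 0 powr (1/s)"
      using s by (intro tendsto_powr') auto
    then show ?case
      using s Q(1) by (simp add: powr_powr)
  qed
qed

section \<open>Random walks with nonnegative mean\<close>

lemma cdf_std_normal_distribution_zero_less_one: "cdf std_normal_distribution 0 < 1"
proof -
  interpret real_distribution std_normal_distribution
    by (rule real_dist_normal_dist)
  have "measure std_normal_distribution {0<..} \<noteq> 0"
  proof
    assume "measure std_normal_distribution {0<..} = 0"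
    then have "{0<..} \<in> null_sets std_normal_distribution"
      by (simp add: emeasure_eq_measure null_sets_def)
    then have "AE x in lborel. x \<in> {0<..} \<longrightarrow> std_normal_density x = 0"
      by (subst (asm) null_sets_density_iff) (auto simp: ennreal_eq_0_iff antisym[OF _ normal_density_nonneg])
    then have "AE x in lborel. x \<notin> {0<..(1::real)}"
    proof eventually_elim
      case (elim x)
      then show ?case
        using normal_density_pos[of 1 0 x] by auto
    qed
    then have "{0<..1::real} \<in> null_sets lborel"
      by (subst AE_iff_null_sets) auto
    then show False
      by (simp add: null_sets_def)
  qed
  moreover have "prob {0<..} = 1 - prob {..0}"
    using prob_compl[of "{..0::real}"] by (simp add: Compl_eq_Diff_UNIV[symmetric] )
  ultimately show ?thesis
    unfolding cdf_def using prob_le_1[of "{..0}"] by linarith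
qed

lemma isCont_cdf_std_normal_distribution: "isCont (cdf std_normal_distribution) x"
proof -
  interpret real_distribution std_normal_distribution
    by (rule real_dist_normal_dist)
  have "{x} \<in> null_sets std_normal_distribution"
  proof (subst null_sets_density_iff)
    show "{x} \<in> sets lborel \<and> (AE y in lborel. y \<in> {x} \<longrightarrow> ennreal (std_normal_density y) = 0)"
    proof
      show "AE y in lborel. y \<in> {x} \<longrightarrow> ennreal (std_normal_density y) = 0"
        using AE_lborel_singleton[of x] by eventually_elim simp
    qed simp
  qed simp
  then show ?thesis
    by (simp add: isCont_cdf null_sets_def measure_def)
qed

text \<open>
  A random walk with nonnegative drift dominates the centred walk, and the central limit theorem at
  the single point \<open>0\<close> gives the latter a limiting probability of being positive. Degenerate steps are
  excluded from that theorem, but then the walk is almost surely deterministic and nonnegative.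
\<close>

lemma (in prob_space) iid_sum_nonneg_prob_not_null:
  fixes X :: "nat \<Rightarrow> 'a \<Rightarrow> real"
  assumes indep: "indep_vars (\<lambda>_. borel) X UNIV"
    and distr: "\<And>i. distr M borel (X i) = distr M borel (X 0)"
    and sq: "integrable M (\<lambda>\<omega>. (X 0 \<omega>)\<^sup>2)"
    and mean: "expectation (X 0) \<ge> 0"
  shows "\<not> (\<lambda>n. prob {\<omega> \<in> space M. (\<Sum>i<n. X i \<omega>) \<ge> 0}) \<longlonglongrightarrow> 0"
proof -
  define m where "m = expectation (X 0)"
  have rv [measurable]: "random_variable borel (X i)" for i
    using indep by (auto simp: indep_vars_def2)
  have transfer: "integrable M (\<lambda>\<omega>. g (X i \<omega>)) \<longleftrightarrow> integrable M (\<lambda>\<omega>. g (X 0 \<omega>))"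
    "expectation (\<lambda>\<omega>. g (X i \<omega>)) = expectation (\<lambda>\<omega>. g (X 0 \<omega>))"
    if [measurable]: "g \<in> borel_measurable borel" for g :: "real \<Rightarrow> real" and i
    using integrable_distr_eq[OF rv[of i] that] integrable_distr_eq[OF rv[of 0] that]
      integral_distr[OF rv[of i] that] integral_distr[OF rv[of 0] that]
    by (simp_all add: distr[of i])
  have sq_i: "integrable M (\<lambda>\<omega>. (X i \<omega>)\<^sup>2)" for i
    using transfer(1)[of "\<lambda>x. x\<^sup>2"] sq by simp
  have int_i: "integrable M (X i)" for i
    by (rule square_integrable_imp_integrable[OF _ sq_i]) simp
  have mean_i: "expectation (X i) = m" for i
    using transfer(2)[of "\<lambda>x. x"] by (simp add: m_def)
  have var_i: "variance (X i) = variance (X 0)" for i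
    using transfer(2)[of "\<lambda>x. (x - m)\<^sup>2"] by (simp add: mean_i)
  show ?thesis
  proof (cases "variance (X 0) = 0")
    case True
    have "AE \<omega> in M. (X i \<omega> - m)\<^sup>2 = 0" for i
    proof (subst integral_nonneg_eq_0_iff_AE[symmetric])
      have "(\<lambda>\<omega>. (X i \<omega> - m)\<^sup>2) = (\<lambda>\<omega>. (X i \<omega>)\<^sup>2 - 2 * m * X i \<omega> + m\<^sup>2)"
        by (simp add: power2_diff fun_eq_iff algebra_simps)
      then show "integrable M (\<lambda>\<omega>. (X i \<omega> - m)\<^sup>2)"
        using sq_i int_i by simp
    qed (use True var_i[of i] mean_i in auto)
    then have "AE \<omega> in M. \<forall>i. X i \<omega> = m"
      by (simp add: AE_all_countable)
    then have "AE \<omega> in M. (\<Sum>i<n. X i \<omega>) \<ge> 0" for n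
      by (rule AE_mp) (use mean in \<open>auto simp: m_def\<close>)
    then have "prob {\<omega> \<in> space M. (\<Sum>i<n. X i \<omega>) \<ge> 0} = 1" for n
      by (subst prob_Collect_eq_1) auto
    then show ?thesis
      by (simp add: LIMSEQ_const_iff)
  next
    case False
    define \<sigma> where "\<sigma> = sqrt (variance (X 0))"
    have var0: "variance (X 0) > 0"
      using False variance_positive[of "X 0"] by linarith
    then have \<sigma>: "\<sigma> > 0" "\<sigma>\<^sup>2 = variance (X 0)"
      by (auto simp: \<sigma>_def)
    let ?S = "\<lambda>n \<omega>. (\<Sum>i<n. X i \<omega> - m) / sqrt (n * \<sigma>\<^sup>2)"
    have "weak_conv_m (\<lambda>n. distr M borel (?S n)) std_normal_distribution"
      by (rule central_limit_theorem[OF indep mean_i \<sigma>(1) sq_i _ distr])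
        (rule trans[OF var_i \<sigma>(2)[symmetric]])
    then have lim: "(\<lambda>n. cdf (distr M borel (?S n)) 0) \<longlonglongrightarrow> cdf std_normal_distribution 0"
      using isCont_cdf_std_normal_distribution by (auto simp: weak_conv_m_def weak_conv_def)
    show ?thesis
    proof
      assume null: "(\<lambda>n. prob {\<omega> \<in> space M. (\<Sum>i<n. X i \<omega>) \<ge> 0}) \<longlonglongrightarrow> 0"
      have bound: "1 - prob {\<omega> \<in> space M. (\<Sum>i<n. X i \<omega>) \<ge> 0} \<le> cdf (distr M borel (?S n)) 0" for n
      proof -
        have "1 - prob {\<omega> \<in> space M. (\<Sum>i<n. X i \<omega>) \<ge> 0} = prob {\<omega> \<in> space M. \<not> (\<Sum>i<n. X i \<omega>) \<ge> 0}"
          by (subst prob_neg) auto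
        also have "\<dots> \<le> prob (?S n -` {..0} \<inter> space M)"
        proof (rule finite_measure_mono)
          show "{\<omega> \<in> space M. \<not> (\<Sum>i<n. X i \<omega>) \<ge> 0} \<subseteq> ?S n -` {..0} \<inter> space M"
          proof
            fix \<omega> assume \<omega>: "\<omega> \<in> {\<omega> \<in> space M. \<not> (\<Sum>i<n. X i \<omega>) \<ge> 0}"
            then have "\<not> (\<Sum>i<n. X i \<omega>) \<ge> 0"
              by simp
            moreover have "(\<Sum>i<n. X i \<omega> - m) = (\<Sum>i<n. X i \<omega>) - n * m"
              by (simp add: sum_subtractf)
            moreover have "n * m \<ge> 0"
              using mean by (simp add: m_def)
            ultimately have "(\<Sum>i<n. X i \<omega> - m) \<le> 0"
              by linarith
            then have "?S n \<omega> \<le> 0"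
              by (intro divide_nonpos_nonneg) auto
            then show "\<omega> \<in> ?S n -` {..0} \<inter> space M"
              using \<omega> by simp
          qed
        qed auto
        also have "\<dots> = cdf (distr M borel (?S n)) 0"
          by (simp add: cdf_def measure_distr)
        finally show ?thesis .
      qed
      have "1 - 0 \<le> cdf std_normal_distribution 0"
        by (rule LIMSEQ_le[OF tendsto_diff[OF tendsto_const null] lim]) (use bound in auto)
      then show False
        using cdf_std_normal_distribution_zero_less_one by simp
    qed
  qed
qed

section \<open>Modes of convergence\<close>

lemma (in prob_space) tendsto_zero_AS_imp_prob:
  assumes [measurable]: "\<And>n. X n \<in> borel_measurable M" and AS: "tendsto_zero_AS M X"
  shows "tendsto_zero_prob M X"
  unfolding tendsto_zero_prob_def
proof safe
  fix \<epsilon> :: real assume \<epsilon>: "\<epsilon> > 0"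
  let ?A = "\<lambda>n. {\<omega> \<in> space M. cmod (X n \<omega>) > \<epsilon>}"
  have "(\<lambda>n. expectation (indicat_real (?A n))) \<longlonglongrightarrow> expectation (\<lambda>_. 0)"
  proof (rule integral_dominated_convergence[where w = "\<lambda>_. 1"])
    show "AE \<omega> in M. (\<lambda>n. indicat_real (?A n) \<omega>) \<longlonglongrightarrow> 0"
      using AS unfolding tendsto_zero_AS_def
    proof eventually_elim
      case (elim \<omega>)
      then have "\<forall>\<^sub>F n in sequentially. cmod (X n \<omega>) < \<epsilon>"
        using \<epsilon> by (auto simp: tendsto_iff)
      then have "\<forall>\<^sub>F n in sequentially. indicat_real (?A n) \<omega> = 0"
        by eventually_elim auto
      then show ?case
        by (rule tendsto_eventually)
    qed
  qed (auto simp: indicator_def)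
  then show "(\<lambda>n. prob (?A n)) \<longlonglongrightarrow> 0"
    by simp
qed

section \<open>The logarithm of a random quadratic\<close>

text \<open>
  The singularity at \<open>a\<close> may lie inside the interval. The integrand is dominated by the sum of the
  one-sided function \<open>x powr (-1/2)\<close> on \<open>{0..1 + |a|}\<close>, translated to start at \<open>a\<close>, and its reflection
  at \<open>a\<close>.
\<close>

lemma integrable_inverse_sqrt_dist:
  fixes a :: real
  shows "integrable lborel (\<lambda>x. indicator {0..1} x * \<bar>x - a\<bar> powr (-1/2))"
proof -
  let ?c = "1 + \<bar>a\<bar>"
  define f where "f x = indicator {0..?c} x * x powr (-1/2)" for x :: real
  have [measurable]: "f \<in> borel_measurable borel"
    unfolding f_def by measurable
  have "(\<lambda>x. x powr (-1/2)) absolutely_integrable_on {0..?c}"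
    by (subst absolutely_integrable_on_iff_nonneg) (auto intro!: integrable_on_powr_from_0)
  then have f: "integrable lborel f"
    unfolding set_integrable_def f_def by (subst (asm) integrable_completion) auto
  have both: "integrable lborel (\<lambda>x. f (- a + 1 * x) + f (a + (- 1) * x))"
    by (intro Bochner_Integration.integrable_add lborel_integrable_real_affine f) auto
  have f_nonneg: "0 \<le> f x" for x
    by (simp add: f_def)
  have dom: "indicator {0..1} x * \<bar>x - a\<bar> powr (-1/2) \<le> f (- a + 1 * x) + f (a + (- 1) * x)" for x
  proof (cases "x \<in> {0..1}")
    case True
    show ?thesis
    proof (cases "a \<le> x")
      case le: True
      then have "x - a \<in> {0..?c}"
        using True by auto
      then have "f (- a + 1 * x) = \<bar>x - a\<bar> powr (-1/2)"
        using le by (simp add: f_def)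
      then show ?thesis
        using True f_nonneg[of "a + (- 1) * x"] by simp
    next
      case False
      then have "a - x \<in> {0..?c}"
        using True by auto
      then have "f (a + (- 1) * x) = \<bar>x - a\<bar> powr (-1/2)"
        using False by (simp add: f_def)
      then show ?thesis
        using True f_nonneg[of "- a + 1 * x"] by simp
    qed
  next
    case False
    then show ?thesis
      using f_nonneg by simp
  qed
  show ?thesis
  proof (rule Bochner_Integration.integrable_bound[OF both])
    have "norm (indicator {0..1} x * \<bar>x - a\<bar> powr (-1/2)) \<le> norm (f (- a + 1 * x) + f (a + (- 1) * x))" for x
      using dom[of x] f_nonneg by simp
    then show "AE x in lborel. norm (indicator {0..1} x * \<bar>x - a\<bar> powr (-1/2))
        \<le> norm (f (- a + 1 * x) + f (a + (- 1) * x))"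
      by (intro AE_I2)
  qed simp
qed

definition quad_modulus :: "complex \<Rightarrow> real \<Rightarrow> real" where
  "quad_modulus z x = cmod (of_real x * z\<^sup>2 + z + 1)"

text \<open>
  After factoring out \<open>z\<^sup>2\<close>, what remains is the distance of \<open>x\<close> from a complex number, which is at
  least its distance from the real part of that number.
\<close>

lemma quad_modulus_lower:
  assumes "z \<noteq> 0"
  shows "(cmod z)\<^sup>2 * \<bar>x + Re ((z + 1) / z\<^sup>2)\<bar> \<le> quad_modulus z x"
proof -
  let ?w = "(z + 1) / z\<^sup>2"
  have "of_real x * z\<^sup>2 + z + 1 = z\<^sup>2 * (of_real x + ?w)"
    using assms by (simp add: field_simps)
  then have "quad_modulus z x = (cmod z)\<^sup>2 * cmod (of_real x + ?w)"
    by (simp add: quad_modulus_def norm_mult norm_power)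
  moreover have "\<bar>x + Re ?w\<bar> \<le> cmod (of_real x + ?w)"
    using abs_Re_le_cmod[of "of_real x + ?w"] by (simp only: plus_complex.sel Re_complex_of_real)
  ultimately show ?thesis
    by (simp add: mult_left_mono)
qed

lemma quad_modulus_upper:
  assumes "x \<in> {0..1}"
  shows "quad_modulus z x \<le> (cmod z)\<^sup>2 + cmod z + 1"
proof -
  have "quad_modulus z x \<le> cmod (of_real x * z\<^sup>2) + cmod z + 1"
    unfolding quad_modulus_def
    by (rule order_trans[OF norm_triangle_ineq]) (simp add: norm_triangle_ineq)
  also have "cmod (of_real x * z\<^sup>2) \<le> (cmod z)\<^sup>2"
    using assms by (auto simp: norm_mult norm_power intro: mult_left_le_one_le)
  finally show ?thesis
    by simp
qed

lemma quad_modulus_measurable [measurable]: "quad_modulus z \<in> borel_measurable borel"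
  unfolding quad_modulus_def by measurable

lemma quad_modulus_pos_AE: "AE x in lborel. quad_modulus z x > 0"
proof (cases "z = 0")
  case True
  then show ?thesis
    by (simp add: quad_modulus_def)
next
  case False
  show ?thesis
    using AE_lborel_singleton[of "- Re ((z + 1) / z\<^sup>2)"]
  proof eventually_elim
    case (elim x)
    then have "0 < (cmod z)\<^sup>2 * \<bar>x + Re ((z + 1) / z\<^sup>2)\<bar>"
      using False by (intro mult_pos_pos) auto
    then show ?case
      using quad_modulus_lower[OF False, of x] by linarith
  qed
qed

text \<open>
  Any negative power dominates the logarithm near \<open>0\<close>. The exponent \<open>-1/4\<close> is chosen so that squaring
  gives \<open>-1/2\<close>, which is still integrable.
\<close>

lemma ln_squared_le_inverse_sqrt:
  fixes q K d C :: real
  assumes K: "K > 0" and d: "d > 0" and q: "K * d \<le> q" "q \<le> C"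
  shows "(ln q)\<^sup>2 \<le> 2 * C\<^sup>2 + 32 * K powr (-1/2) * d powr (-1/2)"
proof -
  define t where "t = (K * d) powr (-1/4)"
  have Kd: "0 < K * d"
    using K d by simp
  then have q_pos: "0 < q" and t: "0 < t"
    using less_le_trans[OF Kd q(1)] K d by (auto simp: t_def)
  have "ln t = - ln (K * d) / 4"
    unfolding t_def using Kd by (subst ln_powr) auto
  moreover have "ln t \<le> t"
    using t by (rule ln_bound)
  moreover have "ln (K * d) \<le> ln q"
    using Kd q(1) q_pos by simp
  ultimately have "- ln q \<le> 4 * t"
    by linarith
  moreover have "ln q \<le> C"
    using ln_bound[OF q_pos] q(2) by linarith
  ultimately have "\<bar>ln q\<bar> \<le> C + 4 * t"
    using q_pos q(2) t by linarith
  then have "(ln q)\<^sup>2 \<le> (C + 4 * t)\<^sup>2"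
    by (metis abs_ge_zero power2_abs power_mono)
  also have "\<dots> \<le> 2 * C\<^sup>2 + 32 * t\<^sup>2"
    using zero_le_power2[of "C - 4 * t"] by (simp add: power2_eq_square algebra_simps)
  also have "t\<^sup>2 = (K * d) powr (-1/2)"
    unfolding t_def by (simp add: power2_eq_square powr_add[symmetric])
  also have "\<dots> = K powr (-1/2) * d powr (-1/2)"
    using K d by (simp add: powr_mult)
  finally show ?thesis
    by simp
qed

lemma integrable_ln_quad_modulus_squared:
  "integrable lborel (\<lambda>x. indicator {0..1} x * (ln (quad_modulus z x))\<^sup>2)"
proof (cases "z = 0")
  case True
  then show ?thesis
    by (simp add: quad_modulus_def)
next
  case False
  define K where "K = (cmod z)\<^sup>2"
  define a where "a = - Re ((z + 1) / z\<^sup>2)"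
  define C where "C = (cmod z)\<^sup>2 + cmod z + 1"
  let ?g = "\<lambda>x. indicator {0..1} x * (2 * C\<^sup>2)
    + 32 * K powr (-1/2) * (indicator {0..1} x * \<bar>x - a\<bar> powr (-1/2))"
  have K: "K > 0"
    using False by (simp add: K_def)
  have "integrable lborel (\<lambda>x::real. indicator {0..1} x * (2 * C\<^sup>2))"
    by (intro integrable_mult_left integrable_real_indicator) auto
  then have dom: "integrable lborel ?g"
    by (intro Bochner_Integration.integrable_add integrable_mult_right integrable_inverse_sqrt_dist)
  show ?thesis
  proof (rule Bochner_Integration.integrable_bound[OF dom])
    show "AE x in lborel. norm (indicator {0..1} x * (ln (quad_modulus z x))\<^sup>2) \<le> norm (?g x)"
      using AE_lborel_singleton[of a]
    proof eventually_elim
      case (elim x)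
      show ?case
      proof (cases "x \<in> {0..1}")
        case True
        have "(ln (quad_modulus z x))\<^sup>2 \<le> 2 * C\<^sup>2 + 32 * K powr (-1/2) * \<bar>x - a\<bar> powr (-1/2)"
        proof (rule ln_squared_le_inverse_sqrt[OF K])
          show "K * \<bar>x - a\<bar> \<le> quad_modulus z x"
            using quad_modulus_lower[OF False, of x] by (simp add: K_def a_def)
          show "quad_modulus z x \<le> C"
            using quad_modulus_upper[OF True] by (simp add: C_def)
        qed (use elim in auto)
        moreover have "0 \<le> 2 * C\<^sup>2 + 32 * K powr (-1/2) * \<bar>x - a\<bar> powr (-1/2)"
          by simp
        ultimately show ?thesis
          using True by simp
      qed simp
    qed
  qed simp
qed

section \<open>Stability regions\<close>

theorem mainTheorem5:
  fixes M :: "'a measure" and \<tau> :: "nat \<Rightarrow> 'a \<Rightarrow> real" and \<eta> :: complex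
  assumes "prob_space M" and "complete_measure M"
    and "prob_space.indep_vars M (\<lambda>_. borel) \<tau> {1..}"
    and "\<And>j. j \<ge> 1 \<Longrightarrow>
           distributed M lborel (\<tau> j) (\<lambda>x. indicator {0..1} x / measure lborel {0..1::real})"
    and "\<eta> \<noteq> 0"
  shows "region_SP M \<tau> \<eta> =
           {z. prob_space.expectation M (\<lambda>\<omega>. ln (cmod (rk_factor \<tau> 1 z \<omega>))) < 0} \<and>
         {z. prob_space.expectation M (\<lambda>\<omega>. ln (cmod (rk_factor \<tau> 1 z \<omega>))) < 0} =
           region_AS M \<tau> \<eta>"
proof -
  interpret prob_space M by fact
  note indep = assms(3) and \<eta> = assms(5)
  let ?f = "\<lambda>x::real. indicator {0..1} x / measure lborel {0..1::real}"
  have unif: "distributed M lborel (\<tau> (Suc i)) ?f" for i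
    by (rule assms(4)) simp
  have \<tau>_rv [measurable]: "random_variable borel (\<tau> (Suc i))" for i
    using distributed_measurable[OF unif[of i]] by simp
  have \<tau>_indep: "indep_vars (\<lambda>_. borel) (\<lambda>i. \<tau> (Suc i)) UNIV"
    by (rule indep_vars_reindex[OF indep]) auto

  (* Steps are numbered from 1, whereas the lemmas on sequences index from 0; hence the shift Suc. *)
  have core: "(tendsto_zero_prob M (rk_approx \<tau> \<eta> z) \<longleftrightarrow>
      expectation (\<lambda>\<omega>. ln (cmod (rk_factor \<tau> 1 z \<omega>))) < 0) \<and>
    (tendsto_zero_AS M (rk_approx \<tau> \<eta> z) \<longleftrightarrow>
      expectation (\<lambda>\<omega>. ln (cmod (rk_factor \<tau> 1 z \<omega>))) < 0)" for z
  proof -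
    define P where "P i \<omega> = quad_modulus z (\<tau> (Suc i) \<omega>)" for i \<omega>
    have P_eq: "P i \<omega> = cmod (rk_factor \<tau> (Suc i) z \<omega>)" for i \<omega>
      by (simp add: P_def quad_modulus_def rk_factor_def)
    have norm_approx: "cmod (rk_approx \<tau> \<eta> z k \<omega>) = cmod \<eta> * (\<Prod>i<k. P i \<omega>)" for k \<omega>
      by (simp add: rk_approx_def norm_mult prod_norm[symmetric] P_eq prod.atLeast1_atMost_eq)
    have approx_rv [measurable]: "rk_approx \<tau> \<eta> z k \<in> borel_measurable M" for k
    proof -
      have "rk_approx \<tau> \<eta> z k = (\<lambda>\<omega>. \<eta> * (\<Prod>i<k. of_real (\<tau> (Suc i) \<omega>) * z\<^sup>2 + z + 1))"
        by (simp add: rk_approx_def rk_factor_def prod.atLeast1_atMost_eq fun_eq_iff)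
      then show ?thesis
        by simp
    qed
    have P_rv [measurable]: "random_variable borel (P i)" for i
      unfolding P_def by measurable
    have P_indep: "indep_vars (\<lambda>_. borel) P UNIV"
      unfolding P_def by (rule indep_vars_compose2[OF \<tau>_indep]) simp
    have lnP_indep: "indep_vars (\<lambda>_. borel) (\<lambda>i \<omega>. ln (P i \<omega>)) UNIV"
      by (rule indep_vars_compose2[OF P_indep]) simp
    have distr_eq: "distr M borel (\<lambda>\<omega>. h (\<tau> (Suc i) \<omega>)) = distr (density lborel ?f) borel h"
      if [measurable]: "h \<in> borel_measurable borel" for h :: "real \<Rightarrow> real" and i
      using distr_distr[of h lborel borel "\<tau> (Suc i)" M]
      by (simp add: distributed_distr_eq_density[OF unif] comp_def)
    have P_distr: "distr M borel (P i) = distr M borel (P 0)" for i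
      using distr_eq[of "quad_modulus z"] by (simp add: P_def[abs_def])
    have lnP_distr: "distr M borel (\<lambda>\<omega>. ln (P i \<omega>)) = distr M borel (\<lambda>\<omega>. ln (P 0 \<omega>))" for i
      using distr_eq[of "\<lambda>x. ln (quad_modulus z x)"] by (simp add: P_def[abs_def])
    have P_pos: "AE \<omega> in M. P i \<omega> > 0" for i
      unfolding P_def
      by (subst distributed_AE2[OF unif]) (use quad_modulus_pos_AE[of z] in auto)
    have "AE \<omega> in M. \<tau> (Suc 0) \<omega> \<in> {0..1}"
      by (subst distributed_AE2[OF unif, where P = "\<lambda>x. x \<in> {0..1}"])
        (auto simp: indicator_def intro!: AE_I2)
    then have "AE \<omega> in M. norm (P 0 \<omega>) \<le> (cmod z)\<^sup>2 + cmod z + 1"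
    proof eventually_elim
      case (elim \<omega>)
      then show ?case
        using quad_modulus_upper[of "\<tau> (Suc 0) \<omega>" z] by (simp add: P_def quad_modulus_def)
    qed
    then have P_int: "integrable M (P 0)"
      by (rule integrable_const_bound) simp
    have "integrable M (\<lambda>\<omega>. (ln (quad_modulus z (\<tau> (Suc 0) \<omega>)))\<^sup>2)"
      by (subst distributed_integrable[OF unif, of "\<lambda>x. (ln (quad_modulus z x))\<^sup>2", symmetric])
        (use integrable_ln_quad_modulus_squared[of z] in auto)
    then have lnP_sq: "integrable M (\<lambda>\<omega>. (ln (P 0 \<omega>))\<^sup>2)"
      by (simp add: P_def)
    then have lnP_int: "integrable M (\<lambda>\<omega>. ln (P 0 \<omega>))"
      by (rule square_integrable_imp_integrable[rotated]) simp
    let ?\<mu> = "expectation (\<lambda>\<omega>. ln (P 0 \<omega>))"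
    have AS: "tendsto_zero_AS M (rk_approx \<tau> \<eta> z)" if "?\<mu> < 0"
    proof -
      have "AE \<omega> in M. (\<lambda>n. \<Prod>i<n. P i \<omega>) \<longlonglongrightarrow> 0"
        using iid_prod_tendsto_zero_AE[OF P_indep P_distr _ P_int P_pos lnP_int that]
        by (simp add: P_eq)
      then show ?thesis
        unfolding tendsto_zero_AS_def
      proof eventually_elim
        case (elim \<omega>)
        then have "(\<lambda>k. cmod (rk_approx \<tau> \<eta> z k \<omega>)) \<longlonglongrightarrow> 0"
          unfolding norm_approx by (rule tendsto_mult_right_zero)
        then show ?case
          by (rule tendsto_norm_zero_cancel)
      qed
    qed
    have SP: "tendsto_zero_prob M (rk_approx \<tau> \<eta> z)" if "tendsto_zero_AS M (rk_approx \<tau> \<eta> z)"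
      by (rule tendsto_zero_AS_imp_prob[OF approx_rv that])
    have neg: "?\<mu> < 0" if SP: "tendsto_zero_prob M (rk_approx \<tau> \<eta> z)"
    proof (rule ccontr)
      assume "\<not> ?\<mu> < 0"
      then have \<mu>: "?\<mu> \<ge> 0" by simp
      let ?A = "\<lambda>n. {\<omega> \<in> space M. (\<Sum>i<n. ln (P i \<omega>)) \<ge> 0}"
      (* Convergence in probability concerns a strict excess, so the threshold is taken below |eta|. *)
      let ?B = "\<lambda>n. {\<omega> \<in> space M. cmod (rk_approx \<tau> \<eta> z n \<omega>) > cmod \<eta> / 2}"
      have le: "prob (?A n) \<le> prob (?B n)" for n
      proof (rule finite_measure_mono_AE)
        have "AE \<omega> in M. \<forall>i. P i \<omega> > 0"
          using P_pos by (simp add: AE_all_countable)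
        then show "AE \<omega> in M. \<omega> \<in> ?A n \<longrightarrow> \<omega> \<in> ?B n"
        proof (eventually_elim, safe)
          fix \<omega> assume pos: "\<forall>i. P i \<omega> > 0" and sum: "(\<Sum>i<n. ln (P i \<omega>)) \<ge> 0"
          have "(\<Prod>i<n. P i \<omega>) = exp (\<Sum>i<n. ln (P i \<omega>))"
            using pos by (simp add: exp_sum)
          then have "1 \<le> (\<Prod>i<n. P i \<omega>)"
            using sum by simp
          then have "cmod \<eta> * 1 \<le> cmod (rk_approx \<tau> \<eta> z n \<omega>)"
            unfolding norm_approx by (intro mult_left_mono) auto
          then show "cmod \<eta> / 2 < cmod (rk_approx \<tau> \<eta> z n \<omega>)"
            using \<eta> by (smt (verit) field_sum_of_halves zero_less_norm_iff)
        qed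
      qed simp
      have "(\<lambda>n. prob (?B n)) \<longlonglongrightarrow> 0"
        using SP \<eta> by (auto simp: tendsto_zero_prob_def dest: spec[of _ "cmod \<eta> / 2"])
      then have "(\<lambda>n. prob (?A n)) \<longlonglongrightarrow> 0"
        by (rule tendsto_sandwich[OF _ _ tendsto_const, rotated 2]) (use le in auto)
      then show False
        using iid_sum_nonneg_prob_not_null[OF lnP_indep lnP_distr lnP_sq \<mu>] by contradiction
    qed
    have "?\<mu> = expectation (\<lambda>\<omega>. ln (cmod (rk_factor \<tau> 1 z \<omega>)))"
      by (simp add: P_eq)
    then show ?thesis
      using AS SP neg by metis
  qed
  show ?thesis
    unfolding region_SP_def region_AS_def using core by blast
qed

end
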